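(* Let $\mathbf M$, $n=\dim\mathbf M$, $\mathcal L$ and the constant $c_0>0$ be as in the context. Then for any $\omega>0$ and $\rho=c_0\omega^{-1/2}$ there exist positive $a_1,a_2$ such that the number of points $|M_\rho|$ in any $\rho$-lattice $M_\rho$ satisfies the inequalities $$a_1\omega^{n/2}\le|M_\rho|\le a_2\omega^{n/2}.$$
   Context: $\mathbf M$ is a compact Riemannian manifold. $\mathcal L$ is an elliptic second-order differential operator on $\mathbf M$, self-adjoint in $L_2(\mathbf M)$, with discrete spectrum $0=\lambda_0<\lambda_1\le\lambda_2\le\dots$ approaching infinity. $H^m(\mathbf M)$ is the Sobolev space of order $m$ based on $L_2$. $\rho$-lattice: there is a natural number $N_{\mathbf M}$ such that for any sufficiently small $\rho>0$ there exists a set of points $\{y_\nu\}\subset\mathbf M$ with: (1) the metric balls $B(y_\nu,\rho/4)$ are disjoint; (2) the balls $B(y_\nu,\rho/2)$ cover $\mathbf M$; (3) the multiplicity of the cover by the balls $B(y_\nu,\rho)$ is at most $N_{\mathbf M}$. Any such set is called a $\rho$-lattice $M_\rho$. Constant $c_0$: put $m_0=[n/2]+1$. Let $C_2>0$ and $\rho_0>0$ be constants such that for any natural $m>n/2$, any $0<\rho<\rho_0$ and any $\rho$-lattice $M_\rho=\{x_k\}$, $$\|f\|_{H^m(\mathbf M)}\le C_2\Big\{\rho^{n/2}\Big(\sum_{x_k\in M_\rho}|f(x_k)|^2\Big)^{1/2}+\rho^{m}\|\mathcal L^{m/2}f\|_{L_2(\mathbf M)}\Big\}$$ for $f\in H^m(\mathbf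 M)$. Then $c_0=\left(\tfrac12C_2^{-1}\right)^{1/m_0}$. *)

theory Defs
  imports "HOL-Analysis.Analysis"
begin

section \<open>Smooth functions and partial derivatives on Euclidean space\<close>

primrec Ck_on :: "nat \<Rightarrow> ('a::real_normed_vector) set \<Rightarrow> ('a \<Rightarrow> 'b::real_normed_vector) \<Rightarrow> bool" where
  "Ck_on 0 S f \<longleftrightarrow> continuous_on S f"
| "Ck_on (Suc k) S f \<longleftrightarrow> (\<forall>x\<in>S. f differentiable (at x)) \<and>
     (\<forall>v. Ck_on k S (\<lambda>x. frechet_derivative f (at x) v))"

text \<open>Only used for open \<open>S\<close>.\<close>
definition smooth_on :: "('a::real_normed_vector) set \<Rightarrow> ('a \<Rightarrow> 'b::real_normed_vector) \<Rightarrow> bool" where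
  "smooth_on S f \<longleftrightarrow> (\<forall>k. Ck_on k S f)"

definition partial :: "'n \<Rightarrow> (real^'n \<Rightarrow> complex) \<Rightarrow> real^'n \<Rightarrow> complex" where
  "partial i f x = frechet_derivative f (at x) (axis i 1)"

text \<open>Multi-indices are lists of coordinate directions.\<close>
fun partials :: "'n list \<Rightarrow> (real^'n \<Rightarrow> complex) \<Rightarrow> real^'n \<Rightarrow> complex" where
  "partials [] f = f"
| "partials (i # is) f = partial i (partials is f)"

section \<open>Compact Riemannian manifolds\<close>

text \<open>
  The manifold is the whole type \<open>'m\<close>; its dimension is \<open>CARD('n)\<close>. A chart is a pair of a
  domain and a coordinate map. Compactness and the Hausdorff property make second countability
  automatic. Connectedness is not assumed.
\<close>
type_synonym ('m, 'n) chart = "'m set \<times> ('m \<Rightarrow> real^'n)"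

definition chart_inv :: "('m, 'n) chart \<Rightarrow> real^'n \<Rightarrow> 'm" where
  "chart_inv c = inv_into (fst c) (snd c)"

definition chart_image :: "('m, 'n) chart \<Rightarrow> (real^'n) set" where
  "chart_image c = snd c ` fst c"

definition transition :: "('m, 'n) chart \<Rightarrow> ('m, 'n) chart \<Rightarrow> real^'n \<Rightarrow> real^'n" where
  "transition c d = snd d \<circ> chart_inv c"

definition smooth_atlas :: "('m::topological_space, 'n::finite) chart set \<Rightarrow> bool" where
  "smooth_atlas A \<longleftrightarrow>
     (\<Union>c\<in>A. fst c) = UNIV \<and>
     (\<forall>c\<in>A. open (fst c) \<and> open (chart_image c) \<and>
        homeomorphism (fst c) (chart_image c) (snd c) (chart_inv c)) \<and>
     (\<forall>c\<in>A. \<forall>d\<in>A. smooth_on (snd c ` (fst c \<inter> fst d)) (transition c d))"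

text \<open>
  \<open>g c x\<close> is the matrix \<open>(g\<^sub>i\<^sub>j(x))\<close> of the metric in the chart \<open>c\<close> at the coordinate point \<open>x\<close>.
  The last clause is the transformation law of a covariant 2-tensor.
\<close>
definition riemannian_metric ::
  "('m::topological_space, 'n::finite) chart set \<Rightarrow> (('m, 'n) chart \<Rightarrow> real^'n \<Rightarrow> real^'n^'n) \<Rightarrow> bool" where
  "riemannian_metric A g \<longleftrightarrow>
     (\<forall>c\<in>A. smooth_on (chart_image c) (g c) \<and>
        (\<forall>x\<in>chart_image c. transpose (g c x) = g c x \<and> (\<forall>v. v \<noteq> 0 \<longrightarrow> v \<bullet> (g c x *v v) > 0))) \<and>
     (\<forall>c\<in>A. \<forall>d\<in>A. \<forall>x\<in>snd c ` (fst c \<inter> fst d).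
        let J = matrix (frechet_derivative (transition c d) (at x))
        in g c x = transpose J ** g d (transition c d x) ** J)"

definition compact_riemannian_manifold ::
  "('m::t2_space, 'n::finite) chart set \<Rightarrow> (('m, 'n) chart \<Rightarrow> real^'n \<Rightarrow> real^'n^'n) \<Rightarrow> bool" where
  "compact_riemannian_manifold A g \<longleftrightarrow>
     compact (UNIV :: 'm set) \<and> smooth_atlas A \<and> riemannian_metric A g"

definition piecewise_C1_curve ::
  "('m::topological_space, 'n::finite) chart set \<Rightarrow> (real \<Rightarrow> 'm) \<Rightarrow> bool" where
  "piecewise_C1_curve A \<gamma> \<longleftrightarrow> continuous_on {0..1} \<gamma> \<and>
     (\<forall>c\<in>A. \<forall>a b. 0 \<le> a \<and> a < b \<and> b \<le> 1 \<and> \<gamma> ` {a..b} \<subseteq> fst c \<longrightarrow>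
        (snd c \<circ> \<gamma>) piecewise_C1_differentiable_on {a..b})"

definition chart_at :: "('m, 'n) chart set \<Rightarrow> 'm \<Rightarrow> ('m, 'n) chart" where
  "chart_at A p = (SOME c. c \<in> A \<and> p \<in> fst c)"

text \<open>By the transformation law the speed does not depend on the chart that is picked.\<close>
definition curve_speed ::
  "('m, 'n::finite) chart set \<Rightarrow> (('m, 'n) chart \<Rightarrow> real^'n \<Rightarrow> real^'n^'n) \<Rightarrow> (real \<Rightarrow> 'm) \<Rightarrow> real \<Rightarrow> real" where
  "curve_speed A g \<gamma> t =
     (let c = chart_at A (\<gamma> t); v = vector_derivative (snd c \<circ> \<gamma>) (at t)
      in sqrt (v \<bullet> (g c (snd c (\<gamma> t)) *v v)))"

definition curve_length ::
  "('m, 'n::finite) chart set \<Rightarrow> (('m, 'n) chart \<Rightarrow> real^'n \<Rightarrow> real^'n^'n) \<Rightarrow> (real \<Rightarrow> 'm) \<Rightarrow> ennreal" where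
  "curve_length A g \<gamma> = (\<integral>\<^sup>+ t \<in> {0..1}. ennreal (curve_speed A g \<gamma> t) \<partial>lborel)"

text \<open>The distance is infinite between points that no curve joins.\<close>
definition riemannian_dist ::
  "('m::topological_space, 'n::finite) chart set \<Rightarrow> (('m, 'n) chart \<Rightarrow> real^'n \<Rightarrow> real^'n^'n) \<Rightarrow> 'm \<Rightarrow> 'm \<Rightarrow> ennreal" where
  "riemannian_dist A g p q =
     (INF \<gamma> \<in> {\<gamma>. piecewise_C1_curve A \<gamma> \<and> \<gamma> 0 = p \<and> \<gamma> 1 = q}. curve_length A g \<gamma>)"

definition metric_ball ::
  "('m::topological_space, 'n::finite) chart set \<Rightarrow> (('m, 'n) chart \<Rightarrow> real^'n \<Rightarrow> real^'n^'n) \<Rightarrow> 'm \<Rightarrow> real \<Rightarrow> 'm set" where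
  "metric_ball A g p r = {q. riemannian_dist A g p q < ennreal r}"

text \<open>The Riemannian measure, \<open>sqrt (det g) dx\<close> in each chart.\<close>
definition riemannian_volume ::
  "('m::topological_space, 'n::finite) chart set \<Rightarrow> (('m, 'n) chart \<Rightarrow> real^'n \<Rightarrow> real^'n^'n) \<Rightarrow> 'm measure" where
  "riemannian_volume A g = (THE \<mu>. sets \<mu> = sets borel \<and>
     (\<forall>c\<in>A. \<forall>E\<in>sets borel. E \<subseteq> fst c \<longrightarrow>
        emeasure \<mu> E = (\<integral>\<^sup>+ x \<in> snd c ` E. ennreal (sqrt (det (g c x))) \<partial>lborel)))"

section \<open>Lattices\<close>

definition is_lattice ::
  "('m::topological_space, 'n::finite) chart set \<Rightarrow> (('m, 'n) chart \<Rightarrow> real^'n \<Rightarrow> real^'n^'n) \<Rightarrow> nat \<Rightarrow> real \<Rightarrow> 'm set \<Rightarrow> bool" where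
  "is_lattice A g N \<rho> Y \<longleftrightarrow>
     disjoint_family_on (\<lambda>y. metric_ball A g y (\<rho> / 4)) Y \<and>
     (\<Union>y\<in>Y. metric_ball A g y (\<rho> / 2)) = UNIV \<and>
     (\<forall>x. finite {y\<in>Y. x \<in> metric_ball A g y \<rho>} \<and> card {y\<in>Y. x \<in> metric_ball A g y \<rho>} \<le> N)"

definition lattice_multiplicity ::
  "('m::topological_space, 'n::finite) chart set \<Rightarrow> (('m, 'n) chart \<Rightarrow> real^'n \<Rightarrow> real^'n^'n) \<Rightarrow> nat \<Rightarrow> bool" where
  "lattice_multiplicity A g N \<longleftrightarrow>
     (\<exists>r>0. \<forall>\<rho>. 0 < \<rho> \<and> \<rho> < r \<longrightarrow> (\<exists>Y. is_lattice A g N \<rho> Y))"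

section \<open>The space of square integrable functions\<close>

text \<open>Elements are functions, not classes; equality in the space is equality almost everywhere.\<close>
definition L2 :: "'m measure \<Rightarrow> ('m \<Rightarrow> complex) set" where
  "L2 \<mu> = {f \<in> borel_measurable \<mu>. integrable \<mu> (\<lambda>x. (cmod (f x))\<^sup>2)}"

definition L2_inner :: "'m measure \<Rightarrow> ('m \<Rightarrow> complex) \<Rightarrow> ('m \<Rightarrow> complex) \<Rightarrow> complex" where
  "L2_inner \<mu> f h = (\<integral>x. f x * cnj (h x) \<partial>\<mu>)"

definition L2_norm :: "'m measure \<Rightarrow> ('m \<Rightarrow> complex) \<Rightarrow> real" where
  "L2_norm \<mu> f = sqrt (\<integral>x. (cmod (f x))\<^sup>2 \<partial>\<mu>)"

section \<open>Elliptic self-adjoint differential operators of second order\<close>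

definition smooth_fun :: "('m, 'n::finite) chart set \<Rightarrow> ('m \<Rightarrow> complex) \<Rightarrow> bool" where
  "smooth_fun A f \<longleftrightarrow> (\<forall>c\<in>A. smooth_on (chart_image c) (f \<circ> chart_inv c))"

text \<open>Only the values of \<open>L\<close> on smooth functions matter.\<close>
definition elliptic_second_order ::
  "('m, 'n::finite) chart set \<Rightarrow> (('m \<Rightarrow> complex) \<Rightarrow> 'm \<Rightarrow> complex) \<Rightarrow> bool" where
  "elliptic_second_order A L \<longleftrightarrow> (\<forall>c\<in>A. \<exists>(a :: 'n \<Rightarrow> 'n \<Rightarrow> real^'n \<Rightarrow> complex) (b :: 'n \<Rightarrow> real^'n \<Rightarrow> complex) e.
     (\<forall>i j. smooth_on (chart_image c) (a i j)) \<and>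
     (\<forall>i. smooth_on (chart_image c) (b i)) \<and>
     smooth_on (chart_image c) e \<and>
     (\<forall>f. smooth_fun A f \<longrightarrow> (\<forall>x\<in>chart_image c.
        L f (chart_inv c x) =
          (\<Sum>i\<in>UNIV. \<Sum>j\<in>UNIV. a i j x * partial i (partial j (f \<circ> chart_inv c)) x) +
          (\<Sum>i\<in>UNIV. b i x * partial i (f \<circ> chart_inv c) x) +
          e x * f (chart_inv c x))) \<and>
     (\<forall>x\<in>chart_image c. \<forall>\<xi>::real^'n. \<xi> \<noteq> 0 \<longrightarrow>
        (\<Sum>i\<in>UNIV. \<Sum>j\<in>UNIV. a i j x * complex_of_real (\<xi> $ i * \<xi> $ j)) \<noteq> 0))"

text \<open>The graph of the closure in the space of square integrable functions of \<open>L\<close> on smooth functions.\<close>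
definition closure_graph ::
  "('m, 'n::finite) chart set \<Rightarrow> 'm measure \<Rightarrow> (('m \<Rightarrow> complex) \<Rightarrow> 'm \<Rightarrow> complex) \<Rightarrow> (('m \<Rightarrow> complex) \<times> ('m \<Rightarrow> complex)) set" where
  "closure_graph A \<mu> L = {(f, h). f \<in> L2 \<mu> \<and> h \<in> L2 \<mu> \<and>
     (\<exists>F :: nat \<Rightarrow> 'm \<Rightarrow> complex. (\<forall>k. smooth_fun A (F k)) \<and>
        (\<lambda>k. L2_norm \<mu> (\<lambda>x. F k x - f x)) \<longlonglongrightarrow> 0 \<and>
        (\<lambda>k. L2_norm \<mu> (\<lambda>x. L (F k) x - h x)) \<longlonglongrightarrow> 0)}"

definition adjoint_graph ::
  "'m measure \<Rightarrow> (('m \<Rightarrow> complex) \<times> ('m \<Rightarrow> complex)) set \<Rightarrow> (('m \<Rightarrow> complex) \<times> ('m \<Rightarrow> complex)) set" where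
  "adjoint_graph \<mu> T = {(f, h). f \<in> L2 \<mu> \<and> h \<in> L2 \<mu> \<and>
     (\<forall>(p, q)\<in>T. L2_inner \<mu> q f = L2_inner \<mu> p h)}"

definition self_adjoint ::
  "'m measure \<Rightarrow> (('m \<Rightarrow> complex) \<times> ('m \<Rightarrow> complex)) set \<Rightarrow> bool" where
  "self_adjoint \<mu> T \<longleftrightarrow> adjoint_graph \<mu> T = T"

text \<open>
  Boundedness of the inverse is not mentioned: for a closed operator it follows from bijectivity.
\<close>
definition spectrum_of ::
  "'m measure \<Rightarrow> (('m \<Rightarrow> complex) \<times> ('m \<Rightarrow> complex)) set \<Rightarrow> complex set" where
  "spectrum_of \<mu> T = {z. \<not> ((\<forall>h\<in>L2 \<mu>. \<exists>(p, q)\<in>T. AE x in \<mu>. q x - z * p x = h x) \<and>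
     (\<forall>(p, q)\<in>T. (AE x in \<mu>. q x - z * p x = 0) \<longrightarrow> (AE x in \<mu>. p x = 0)))}"

text \<open>
  The spectrum is the sequence \<open>0 = lam 0 < lam 1 \<le> lam 2 \<le> \<dots>\<close> tending to infinity. Each eigenvalue
  is repeated according to its multiplicity: this is what the complete orthonormal system \<open>u\<close> of
  eigenfunctions, \<open>L (u k) = lam k * u k\<close>, expresses.
\<close>
definition discrete_spectrum ::
  "'m measure \<Rightarrow> (('m \<Rightarrow> complex) \<times> ('m \<Rightarrow> complex)) set \<Rightarrow> (nat \<Rightarrow> real) \<Rightarrow> (nat \<Rightarrow> 'm \<Rightarrow> complex) \<Rightarrow> bool" where
  "discrete_spectrum \<mu> T lam u \<longleftrightarrow>
     spectrum_of \<mu> T = complex_of_real ` range lam \<and>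
     lam 0 = 0 \<and> 0 < lam 1 \<and> mono lam \<and> filterlim lam at_top sequentially \<and>
     (\<forall>k. (u k, \<lambda>x. complex_of_real (lam k) * u k x) \<in> T) \<and>
     (\<forall>j k. L2_inner \<mu> (u j) (u k) = (if j = k then 1 else 0)) \<and>
     (\<forall>f\<in>L2 \<mu>. (\<forall>k. L2_inner \<mu> f (u k) = 0) \<longrightarrow> (AE x in \<mu>. f x = 0))"

text \<open>\<open>L\<^sup>s f\<close> for \<open>s > 0\<close> by the spectral theorem; it is determined up to a null set.\<close>
definition operator_power ::
  "'m measure \<Rightarrow> (nat \<Rightarrow> real) \<Rightarrow> (nat \<Rightarrow> 'm \<Rightarrow> complex) \<Rightarrow> real \<Rightarrow> ('m \<Rightarrow> complex) \<Rightarrow> 'm \<Rightarrow> complex" where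
  "operator_power \<mu> lam u s f = (SOME h. h \<in> L2 \<mu> \<and>
     (\<forall>k. L2_inner \<mu> h (u k) = complex_of_real (lam k powr s) * L2_inner \<mu> f (u k)))"

section \<open>Sobolev spaces\<close>

definition test_function :: "(real^'n::finite) set \<Rightarrow> (real^'n \<Rightarrow> complex) \<Rightarrow> bool" where
  "test_function \<Omega> \<psi> \<longleftrightarrow> smooth_on UNIV \<psi> \<and>
     (\<exists>K. compact K \<and> K \<subseteq> \<Omega> \<and> (\<forall>x. x \<notin> K \<longrightarrow> \<psi> x = 0))"

definition loc_L2 :: "(real^'n::finite) set \<Rightarrow> (real^'n \<Rightarrow> complex) \<Rightarrow> bool" where
  "loc_L2 \<Omega> h \<longleftrightarrow> set_borel_measurable lborel \<Omega> h \<and>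
     (\<forall>K. compact K \<and> K \<subseteq> \<Omega> \<longrightarrow> set_integrable lborel K (\<lambda>x. (cmod (h x))\<^sup>2))"

definition is_weak_derivative ::
  "(real^'n::finite) set \<Rightarrow> 'n list \<Rightarrow> (real^'n \<Rightarrow> complex) \<Rightarrow> (real^'n \<Rightarrow> complex) \<Rightarrow> bool" where
  "is_weak_derivative \<Omega> is f h \<longleftrightarrow> loc_L2 \<Omega> h \<and>
     (\<forall>\<psi>. test_function \<Omega> \<psi> \<longrightarrow>
        (LINT x:\<Omega>|lborel. f x * partials is \<psi> x) =
        (- 1) ^ length is * (LINT x:\<Omega>|lborel. h x * \<psi> x))"

definition weak_derivative ::
  "(real^'n::finite) set \<Rightarrow> 'n list \<Rightarrow> (real^'n \<Rightarrow> complex) \<Rightarrow> real^'n \<Rightarrow> complex" where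
  "weak_derivative \<Omega> is f = (SOME h. is_weak_derivative \<Omega> is f h)"

text \<open>On a compact manifold local square integrability of the derivatives in all charts suffices.\<close>
definition sobolev_space ::
  "('m, 'n::finite) chart set \<Rightarrow> 'm measure \<Rightarrow> nat \<Rightarrow> ('m \<Rightarrow> complex) set" where
  "sobolev_space A \<mu> m = {f \<in> L2 \<mu>. \<forall>c\<in>A. \<forall>is. length is \<le> m \<longrightarrow>
     (\<exists>h. is_weak_derivative (chart_image c) is (f \<circ> chart_inv c) h)}"

text \<open>
  A Sobolev norm is fixed by a finite cover of the manifold by compact sets, each given in the
  coordinates of a chart; different covers give equivalent norms.
\<close>
definition compact_chart_cover ::
  "('m, 'n::finite) chart set \<Rightarrow> (('m, 'n) chart \<times> (real^'n) set) set \<Rightarrow> bool" where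
  "compact_chart_cover A P \<longleftrightarrow> finite P \<and>
     (\<forall>(c, K)\<in>P. c \<in> A \<and> compact K \<and> K \<subseteq> chart_image c) \<and>
     (\<Union>(c, K)\<in>P. chart_inv c ` K) = UNIV"

definition sobolev_norm ::
  "(('m, 'n::finite) chart \<times> (real^'n) set) set \<Rightarrow> nat \<Rightarrow> ('m \<Rightarrow> complex) \<Rightarrow> real" where
  "sobolev_norm P m f = sqrt (\<Sum>(c, K)\<in>P. \<Sum>is\<in>{is. length is \<le> m}.
     LINT x:K|lborel. (cmod (weak_derivative (chart_image c) is (f \<circ> chart_inv c) x))\<^sup>2)"

section \<open>The sampling estimate and the constant \<open>c\<^sub>0\<close>\<close>

text \<open>
  For \<open>m > n/2\<close> elements of the Sobolev space have continuous representatives, and \<open>f (x\<^sub>k)\<close> refers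
  to that representative; hence the continuity of \<open>f\<close>.

  The norm on the left is the Sobolev norm of order \<open>s m\<close>. The estimate of the source is
  the case \<open>s m = m\<close>. In that case, however, no constants satisfy it: for a smooth
  \<open>f\<close> vanishing on the lattice, \<open>\<rho>\<^sup>m \<parallel>L\<^bsup>m/2\<^esup> f\<parallel>\<close> is at most a constant times \<open>\<rho>\<^sup>m\<close> times the Sobolev norm
  of order \<open>m\<close> of \<open>f\<close>, which is too small as \<open>\<rho>\<close> tends to 0. Smaller orders, such as \<open>s m = 0\<close>
  (the norm of square integrable functions), do not have this defect.
\<close>
definition sampling_estimate ::
  "('m::topological_space, 'n::finite) chart set \<Rightarrow> (('m, 'n) chart \<Rightarrow> real^'n \<Rightarrow> real^'n^'n) \<Rightarrow> nat \<Rightarrow>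
   (nat \<Rightarrow> real) \<Rightarrow> (nat \<Rightarrow> 'm \<Rightarrow> complex) \<Rightarrow> (('m, 'n) chart \<times> (real^'n) set) set \<Rightarrow> (nat \<Rightarrow> nat) \<Rightarrow> real \<Rightarrow> real \<Rightarrow> bool" where
  "sampling_estimate A g N lam u P s C\<^sub>2 \<rho>\<^sub>0 \<longleftrightarrow>
     (\<forall>m::nat. \<forall>\<rho> Y f. real m > real CARD('n) / 2 \<and> 0 < \<rho> \<and> \<rho> < \<rho>\<^sub>0 \<and> is_lattice A g N \<rho> Y \<and>
        f \<in> sobolev_space A (riemannian_volume A g) m \<and> continuous_on UNIV f \<longrightarrow>
        sobolev_norm P (s m) f \<le> C\<^sub>2 *
          (\<rho> powr (real CARD('n) / 2) * sqrt (\<Sum>x\<in>Y. (cmod (f x))\<^sup>2) +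
           \<rho> ^ m * L2_norm (riemannian_volume A g)
             (operator_power (riemannian_volume A g) lam u (real m / 2) f)))"

definition c0 :: "nat \<Rightarrow> real \<Rightarrow> real" where
  "c0 n C\<^sub>2 = (1 / 2 * inverse C\<^sub>2) powr (1 / real (n div 2 + 1))"

end

theory Submission
  imports Defs
begin

text \<open>
  In a coordinate ball that is relatively compact in a chart, the Riemannian and the Euclidean norms of
  tangent vectors are comparable, hence so are the two distances at small scales, and everything reduces
  to the Lebesgue measure of Euclidean balls of radius proportional to \<open>\<rho>\<close>. The disjoint balls of radius
  \<open>\<rho>/4\<close> contain such balls, so at most \<open>O(\<rho>\<^sup>-\<^sup>n)\<close> lattice points lie in each of finitely many coordinate
  balls covering the manifold; the balls of radius \<open>\<rho>/2\<close> cover one fixed coordinate ball, so at least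
  \<open>c \<rho>\<^sup>-\<^sup>n\<close> of them are needed.
\<close>

section \<open>Charts and their inverses\<close>

lemma smooth_atlas_chart:
  assumes "smooth_atlas A" "c \<in> A"
  shows "open (fst c)" "open (chart_image c)"
    "homeomorphism (fst c) (chart_image c) (snd c) (chart_inv c)"
  using assms unfolding smooth_atlas_def by blast+

lemma chart_inv_mem: "x \<in> chart_image c \<Longrightarrow> chart_inv c x \<in> fst c"
  unfolding chart_image_def chart_inv_def by (rule inv_into_into)

lemma chart_chart_inv: "x \<in> chart_image c \<Longrightarrow> snd c (chart_inv c x) = x"
  unfolding chart_image_def chart_inv_def by (rule f_inv_into_f)

lemma chart_inv_chart:
  assumes "smooth_atlas A" "c \<in> A" "p \<in> fst c"
  shows "chart_inv c (snd c p) = p"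
  using homeomorphism_apply1[OF smooth_atlas_chart(3)] assms by blast

lemma open_chart_inv_image:
  assumes "smooth_atlas A" "c \<in> A" "open W" "W \<subseteq> chart_image c"
  shows "open (chart_inv c ` W)"
proof -
  have "openin (top_of_set (fst c)) (chart_inv c ` W)"
    using homeomorphism_imp_open_map[OF homeomorphism_symD[OF smooth_atlas_chart(3)[OF assms(1,2)]]] assms
    by (simp add: open_subset)
  then show ?thesis
    using smooth_atlas_chart(1)[OF assms(1,2)] openin_open_trans by blast
qed

lemma chart_at_mem:
  assumes "smooth_atlas A"
  shows "chart_at A p \<in> A" "p \<in> fst (chart_at A p)"
proof -
  have "\<exists>c. c \<in> A \<and> p \<in> fst c"
    using assms unfolding smooth_atlas_def by blast
  from someI_ex[OF this] show "chart_at A p \<in> A" "p \<in> fst (chart_at A p)"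
    unfolding chart_at_def by auto
qed

section \<open>Velocity and speed of curves under change of chart\<close>

lemma transition_has_derivative:
  assumes "smooth_atlas A" "c \<in> A" "d \<in> A" "p \<in> fst c" "p \<in> fst d"
  shows "(transition c d has_derivative frechet_derivative (transition c d) (at (snd c p))) (at (snd c p))"
proof -
  have "Ck_on (Suc 0) (snd c ` (fst c \<inter> fst d)) (transition c d)"
    using assms unfolding smooth_atlas_def smooth_on_def by blast
  then have "transition c d differentiable (at (snd c p))"
    using assms by auto
  then show ?thesis
    using frechet_derivative_works by blast
qed

lemma transition_continuous_derivative:
  assumes "smooth_atlas A" "c \<in> A" "d \<in> A"
  shows "continuous_on (snd c ` (fst c \<inter> fst d)) (\<lambda>x. frechet_derivative (transition c d) (at x) v)"
proof -
  have "Ck_on (Suc 0) (snd c ` (fst c \<inter> fst d)) (transition c d)"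
    using assms unfolding smooth_atlas_def smooth_on_def by blast
  then show ?thesis by simp
qed

text \<open>Chain rule for \<open>snd d \<circ> \<gamma> = transition c d \<circ> (snd c \<circ>
  \<gamma>)\<close>. This identity holds only at times when the curve is in \<open>fst c\<close>;
  continuity of \<open>\<gamma>\<close> at \<open>t\<close> and openness of \<open>fst c\<close>
  make it hold near \<open>t\<close>, which is all that a derivative sees.\<close>

lemma change_of_chart_has_vector_derivative:
  assumes A: "smooth_atlas A" "c \<in> A" "d \<in> A" and \<gamma>: "\<gamma> t \<in> fst c" "\<gamma> t \<in> fst d" "isCont \<gamma> t"
    and v: "((snd c \<circ> \<gamma>) has_vector_derivative v) (at t)"
  shows "((snd d \<circ> \<gamma>) has_vector_derivative
    frechet_derivative (transition c d) (at (snd c (\<gamma> t))) v) (at t)"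
proof -
  let ?T = "transition c d" and ?T' = "frechet_derivative (transition c d) (at (snd c (\<gamma> t)))"
  have T: "(?T has_derivative ?T') (at ((snd c \<circ> \<gamma>) t))"
    using transition_has_derivative[OF A \<gamma>(1,2)] by simp
  have "((?T \<circ> (snd c \<circ> \<gamma>)) has_derivative (?T' \<circ> (\<lambda>h. h *\<^sub>R v))) (at t)"
    using v T unfolding has_vector_derivative_def by (intro diff_chain_at)
  moreover have "?T' \<circ> (\<lambda>h. h *\<^sub>R v) = (\<lambda>h. h *\<^sub>R ?T' v)"
    using linear_cmul[OF has_derivative_linear[OF T]] by auto
  ultimately have der: "((?T \<circ> (snd c \<circ> \<gamma>)) has_derivative (\<lambda>h. h *\<^sub>R ?T' v)) (at t)"
    by simp
  have eq: "(?T \<circ> (snd c \<circ> \<gamma>)) x = (snd d \<circ> \<gamma>) x" if "\<gamma> x \<in> fst c" for x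
    using that chart_inv_chart[OF A(1,2)] by (simp add: transition_def)
  have "eventually (\<lambda>x. \<gamma> x \<in> fst c) (at t)"
    using \<gamma>(1,3) smooth_atlas_chart(1)[OF A(1,2)] unfolding isCont_def by (metis topological_tendstoD)
  then have ev: "eventually (\<lambda>x. (?T \<circ> (snd c \<circ> \<gamma>)) x = (snd d \<circ> \<gamma>) x) (at t)"
    by (rule eventually_mono) (rule eq)
  show ?thesis
    unfolding has_vector_derivative_def
    by (rule has_derivative_transform_eventually[OF der ev eq[OF \<gamma>(1)]]) simp
qed

text \<open>\<open>curve_speed\<close> is computed in a chart picked by Hilbert choice, over which
  there is no control. If \<open>J\<close> is the Jacobian of the transition to the picked chart
  \<open>d\<close>, the velocity there is \<open>J *v v\<close>, and the tensor law moves both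
  factors \<open>J\<close> from the metric onto the vectors. Hence any chart around the point may be
  used.\<close>

lemma curve_speed_chart:
  fixes g :: "('m::topological_space, 'n::finite) chart \<Rightarrow> real^'n \<Rightarrow> real^'n^'n"
  assumes A: "smooth_atlas A" and g: "riemannian_metric A g" and c: "c \<in> A"
    and \<gamma>: "\<gamma> t \<in> fst c" "isCont \<gamma> t"
    and v: "((snd c \<circ> \<gamma>) has_vector_derivative v) (at t)"
  shows "curve_speed A g \<gamma> t = sqrt (v \<bullet> (g c (snd c (\<gamma> t)) *v v))"
proof -
  define d where "d = chart_at A (\<gamma> t)"
  define x where "x = snd c (\<gamma> t)"
  define T' where "T' = frechet_derivative (transition c d) (at x)"
  define J where "J = matrix T'"
  have d: "d \<in> A" "\<gamma> t \<in> fst d"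
    using chart_at_mem[OF A] by (auto simp: d_def)
  have "linear T'"
    using has_derivative_linear[OF transition_has_derivative[OF A c d(1) \<gamma>(1) d(2)]]
    by (simp add: T'_def x_def)
  then have J: "J *v v = T' v"
    by (simp add: J_def matrix_works)
  have "transition c d x = snd d (\<gamma> t)"
    using chart_inv_chart[OF A c \<gamma>(1)] by (simp add: transition_def x_def)
  moreover have "x \<in> snd c ` (fst c \<inter> fst d)"
    using \<gamma> d by (auto simp: x_def)
  ultimately have law: "g c x = transpose J ** g d (snd d (\<gamma> t)) ** J"
    using g c d(1) unfolding riemannian_metric_def Let_def J_def T'_def by metis
  have "v \<bullet> (g c x *v v) = (J *v v) \<bullet> (g d (snd d (\<gamma> t)) *v (J *v v))"
    unfolding law matrix_vector_mul_assoc[symmetric] transpose_matrix_vector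
    by (metis dot_lmul_matrix inner_commute)
  moreover have "vector_derivative (snd d \<circ> \<gamma>) (at t) = T' v"
    using change_of_chart_has_vector_derivative[OF A c d(1) \<gamma>(1) d(2) \<gamma>(2) v]
    by (simp add: vector_derivative_at T'_def x_def)
  ultimately show ?thesis
    by (simp add: curve_speed_def Let_def d_def[symmetric] J x_def)
qed

section \<open>Upper bound for the distance by coordinate segments\<close>

lemma continuous_on_isCont_interior:
  fixes \<gamma> :: "real \<Rightarrow> 'm::topological_space"
  assumes "continuous_on {0..1} \<gamma>" "0 < t" "t < 1"
  shows "isCont \<gamma> t"
  using assms continuous_on_interior[of "{0..1}" \<gamma> t] by (simp add: interior_atLeastAtMost_real)

text \<open>The straight segment from \<open>z\<close> to \<open>w\<close>, carried to the manifold
  by \<open>chart_inv c\<close>, competes in the infimum. Convexity keeps it in \<open>S\<close>,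
  where its speed is at most \<open>\<Lambda> * norm (w - z)\<close>. Most of the work is to show
  that it is piecewise C1 in every chart \<open>d\<close> of the atlas, not only in
  \<open>c\<close>.\<close>

lemma riemannian_dist_le_segment:
  fixes g :: "('m::topological_space, 'n::finite) chart \<Rightarrow> real^'n \<Rightarrow> real^'n^'n"
  assumes A: "smooth_atlas A" and g: "riemannian_metric A g" and c: "c \<in> A"
    and S: "convex S" "S \<subseteq> chart_image c" and z: "z \<in> S" and w: "w \<in> S"
    and bound: "\<And>x v. x \<in> S \<Longrightarrow> sqrt (v \<bullet> (g c x *v v)) \<le> \<Lambda> * norm v"
  shows "riemannian_dist A g (chart_inv c z) (chart_inv c w) \<le> ennreal (\<Lambda> * norm (w - z))"
proof -
  define l where "l = linepath z w"
  define \<gamma> where "\<gamma> = chart_inv c \<circ> l"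
  note hom = smooth_atlas_chart(3)[OF A c]
  have lS: "l t \<in> S" if "t \<in> {0..1}" for t
    using that S z w closed_segment_subset[of z S w] linepath_in_path[of t z w]
    by (auto simp: l_def)
  have l': "(l has_vector_derivative (w - z)) (at t)" for t
    unfolding l_def by (rule has_vector_derivative_linepath_within)
  have cont: "continuous_on {0..1} \<gamma>"
    unfolding \<gamma>_def using lS S
    by (intro continuous_on_compose continuous_on_subset[OF homeomorphism_cont2[OF hom]])
      (auto simp: l_def)
  have \<gamma>c: "\<gamma> t \<in> fst c" "snd c (\<gamma> t) = l t" if "t \<in> {0..1}" for t
    using lS[OF that] S(2) chart_inv_mem[of _ c] chart_chart_inv[of _ c] by (auto simp: \<gamma>_def)
  have \<gamma>': "((snd c \<circ> \<gamma>) has_vector_derivative (w - z)) (at t)" if "0 < t" "t < 1" for t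
    using l'[of t]
    by (rule has_vector_derivative_transform_within_open[where S = "{0<..<1}"]) (use that \<gamma>c in auto)
  have isC: "isCont \<gamma> t" if "0 < t" "t < 1" for t
    using continuous_on_isCont_interior[OF cont] that by blast
  have pw: "(snd d \<circ> \<gamma>) piecewise_C1_differentiable_on {a..b}"
    if d: "d \<in> A" and ab: "0 \<le> a" "a < b" "b \<le> 1" and sub: "\<gamma> ` {a..b} \<subseteq> fst d" for d a b
    unfolding piecewise_C1_differentiable_on_def C1_differentiable_on_def
  \<comment> \<open>The endpoints are declared exceptional: beyond them the line may leave the chart
    image, where \<open>chart_inv c\<close> has no meaning, so two-sided derivatives are available
    only inside the unit interval.\<close>
  proof (intro conjI exI[of _ "{0, 1}"] exI ballI)
    show "continuous_on {a..b} (snd d \<circ> \<gamma>)"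
      using sub ab by (intro continuous_on_compose continuous_on_subset[OF cont]
        continuous_on_subset[OF homeomorphism_cont1[OF smooth_atlas_chart(3)[OF A d]]]) auto
    show "finite {0::real, 1}" by simp
    show "((snd d \<circ> \<gamma>) has_vector_derivative
        frechet_derivative (transition c d) (at (l t)) (w - z)) (at t)"
      if "t \<in> {a..b} - {0, 1}" for t
    proof -
      from that ab have t: "0 < t" "t < 1" "t \<in> {0..1}" by auto
      have "\<gamma> t \<in> fst d" using sub that by blast
      then show ?thesis
        using change_of_chart_has_vector_derivative[OF A c d \<gamma>c(1)[OF t(3)] _ isC[OF t(1,2)] \<gamma>'[OF t(1,2)]]
          \<gamma>c(2)[OF t(3)] by simp
    qed
    show "continuous_on ({a..b} - {0, 1}) (\<lambda>t. frechet_derivative (transition c d) (at (l t)) (w - z))"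
    proof (rule continuous_on_compose2[OF transition_continuous_derivative[OF A c d]])
      show "continuous_on ({a..b} - {0, 1}) l" by (auto simp: l_def)
      show "l ` ({a..b} - {0, 1}) \<subseteq> snd c ` (fst c \<inter> fst d)"
      proof (rule image_subsetI)
        fix t assume t: "t \<in> {a..b} - {0, 1}"
        then have "t \<in> {0..1}" using ab by auto
        then show "l t \<in> snd c ` (fst c \<inter> fst d)"
          using \<gamma>c[of t] sub t by (metis DiffD1 IntI image_subset_iff imageI)
      qed
    qed
  qed
  have "riemannian_dist A g (chart_inv c z) (chart_inv c w) \<le> curve_length A g \<gamma>"
    unfolding riemannian_dist_def using pw cont
    by (intro INF_lower) (auto simp: piecewise_C1_curve_def \<gamma>_def l_def linepath_def)
  also have "\<dots> \<le> (\<integral>\<^sup>+ t \<in> {0..1::real}. ennreal (\<Lambda> * norm (w - z)) \<partial>lborel)"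
    unfolding curve_length_def
  proof (rule nn_integral_mono_AE)
    \<comment> \<open>The speed is known only at interior times; the two endpoints form a null
      set.\<close>
    have "AE t in lborel. t \<noteq> (0::real)" "AE t in lborel. t \<noteq> (1::real)"
      by (rule AE_lborel_singleton)+
    then show "AE t in lborel. ennreal (curve_speed A g \<gamma> t) * indicator {0..1} t
        \<le> ennreal (\<Lambda> * norm (w - z)) * indicator {0..1} t"
    proof eventually_elim
      case (elim t)
      show ?case
      proof (cases "t \<in> {0..1}")
        case True
        with elim have "0 < t" "t < 1" by auto
        then have "curve_speed A g \<gamma> t = sqrt ((w - z) \<bullet> (g c (l t) *v (w - z)))"
          using curve_speed_chart[OF A g c \<gamma>c(1)[OF True] isC \<gamma>'] \<gamma>c(2)[OF True] by simp
        then show ?thesis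
          using True bound[OF lS[OF True], of "w - z"] by (simp add: ennreal_leI)
      qed simp
    qed
  qed
  also have "\<dots> = ennreal (\<Lambda> * norm (w - z))"
    by (simp add: nn_integral_cmult_indicator)
  finally show ?thesis .
qed

section \<open>Lower bound for the length of curves\<close>

text \<open>If the right side is infinite there is nothing to prove. Otherwise the derivative,
  extended by zero, is Lebesgue integrable; the fundamental theorem with finitely many exceptional
  points gives its gauge integral over the interval, and the two integrals agree. The derivative may
  be unbounded near the exceptional points, hence the extended nonnegative integral.\<close>

lemma norm_increment_le_nn_integral:
  fixes f D :: "real \<Rightarrow> 'a::euclidean_space"
  assumes "a < b" "finite S" and f: "continuous_on {a..b} f"
    and f': "\<And>t. t \<in> {a<..<b} - S \<Longrightarrow> (f has_vector_derivative D t) (at t)"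
    and D: "continuous_on ({a<..<b} - S) D"
  shows "ennreal (norm (f b - f a)) \<le> (\<integral>\<^sup>+ t \<in> {a<..<b} - S. ennreal (norm (D t)) \<partial>lborel)"
    (is "_ \<le> ?J")
proof (cases "?J = \<infinity>")
  case False
  define E where "E = {a<..<b} - S"
  define h where "h = (\<lambda>t. indicator E t *\<^sub>R D t)"
  have "open E"
    unfolding E_def using \<open>finite S\<close> by (intro open_Diff finite_imp_closed) auto
  then have meas: "h \<in> borel_measurable borel"
    unfolding h_def using D
    by (intro borel_measurable_continuous_on_indicator) (auto simp: E_def)
  have J: "?J = (\<integral>\<^sup>+ t. ennreal (norm (h t)) \<partial>lborel)"
    by (intro nn_integral_cong) (auto simp: h_def E_def indicator_def)
  have int: "integrable lborel h"
    using False meas unfolding J by (intro integrableI_bounded) (auto simp: less_top[symmetric])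
  have "(h has_integral (f b - f a)) {a..b}"
  proof (rule fundamental_theorem_of_calculus_interior_strong[OF \<open>finite S\<close>])
    show "(f has_vector_derivative h t) (at t)" if "t \<in> {a<..<b} - S" for t
      using f'[OF that] that by (simp add: h_def E_def)
  qed (use \<open>a < b\<close> f in auto)
  then have "(h has_integral (f b - f a)) UNIV"
    by (rule has_integral_on_superset) (auto simp: h_def E_def)
  then have "integral\<^sup>L lborel h = f b - f a"
    using has_integral_integral_lborel[OF int] has_integral_unique by blast
  then have "norm (f b - f a) \<le> (\<integral>t. norm (h t) \<partial>lborel)"
    using integral_norm_bound[of lborel h] by simp
  also have "ennreal (\<integral>t. norm (h t) \<partial>lborel) = ?J"
    unfolding J using int by (intro nn_integral_eq_integral[symmetric]) auto
  finally show ?thesis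
    by (simp add: ennreal_leI)
qed simp

text \<open>On \<open>{a..b}\<close> the speed dominates \<open>\<kappa>\<close> times the Euclidean
  speed of the coordinate curve, whose integral dominates the chord. The remaining times contribute
  a nonnegative amount to the length.\<close>

lemma curve_length_ge_chord:
  fixes g :: "('m::topological_space, 'n::finite) chart \<Rightarrow> real^'n \<Rightarrow> real^'n^'n"
  assumes A: "smooth_atlas A" and g: "riemannian_metric A g" and c: "c \<in> A"
    and \<gamma>: "piecewise_C1_curve A \<gamma>" and ab: "0 \<le> a" "a < b" "b \<le> 1"
    and S: "\<gamma> ` {a..b} \<subseteq> fst c"
    and \<kappa>: "0 \<le> \<kappa>" "\<And>t v. t \<in> {a..b} \<Longrightarrow> \<kappa> * norm v \<le> sqrt (v \<bullet> (g c (snd c (\<gamma> t)) *v v))"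
  shows "ennreal (\<kappa> * norm (snd c (\<gamma> b) - snd c (\<gamma> a))) \<le> curve_length A g \<gamma>"
proof -
  have "(snd c \<circ> \<gamma>) piecewise_C1_differentiable_on {a..b}"
    using \<gamma> c ab S unfolding piecewise_C1_curve_def by blast
  then obtain F D where F: "continuous_on {a..b} (snd c \<circ> \<gamma>)" "finite F"
      "\<And>t. t \<in> {a..b} - F \<Longrightarrow> ((snd c \<circ> \<gamma>) has_vector_derivative D t) (at t)"
      "continuous_on ({a..b} - F) D"
    unfolding piecewise_C1_differentiable_on_def C1_differentiable_on_def by blast
  define E where "E = {a<..<b} - F"
  have "open E"
    unfolding E_def using F(2) by (intro open_Diff finite_imp_closed) auto
  have D: "continuous_on E D"
    using F(4) by (rule continuous_on_subset) (auto simp: E_def)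
  \<comment> \<open>Measurability of the Euclidean speed on \<open>E\<close> allows
    \<open>\<kappa>\<close> to be moved under the integral below.\<close>
  then have "(\<lambda>t. indicator E t *\<^sub>R D t) \<in> borel_measurable borel"
    using \<open>open E\<close> by (intro borel_measurable_continuous_on_indicator) auto
  then have "(\<lambda>t. ennreal (norm (indicator E t *\<^sub>R D t))) \<in> borel_measurable lborel"
    by measurable
  also have "(\<lambda>t. ennreal (norm (indicator E t *\<^sub>R D t))) = (\<lambda>t. ennreal (norm (D t)) * indicator E t)"
    by (auto simp: indicator_def)
  finally have meas: "(\<lambda>t. ennreal (norm (D t)) * indicator E t) \<in> borel_measurable lborel" .
  have "ennreal (\<kappa> * norm (snd c (\<gamma> b) - snd c (\<gamma> a)))
      = ennreal \<kappa> * ennreal (norm ((snd c \<circ> \<gamma>) b - (snd c \<circ> \<gamma>) a))"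
    using \<kappa>(1) by (simp add: ennreal_mult)
  also have "\<dots> \<le> ennreal \<kappa> * (\<integral>\<^sup>+ t \<in> E. ennreal (norm (D t)) \<partial>lborel)"
    unfolding E_def using D[unfolded E_def]
    by (intro mult_left_mono norm_increment_le_nn_integral[OF ab(2) F(2,1)] F(3)) auto
  also have "\<dots> = (\<integral>\<^sup>+ t. ennreal \<kappa> * (ennreal (norm (D t)) * indicator E t) \<partial>lborel)"
    using meas by (rule nn_integral_cmult[symmetric])
  also have "\<dots> \<le> curve_length A g \<gamma>"
    unfolding curve_length_def
  proof (rule nn_integral_mono)
    fix t
    show "ennreal \<kappa> * (ennreal (norm (D t)) * indicator E t)
        \<le> ennreal (curve_speed A g \<gamma> t) * indicator {0..1} t"
    proof (cases "t \<in> E")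
      case True
      then have t: "t \<in> {a..b}" "t \<in> {a..b} - F" "0 < t" "t < 1"
        using ab by (auto simp: E_def)
      have "isCont \<gamma> t"
        using \<gamma> t continuous_on_isCont_interior unfolding piecewise_C1_curve_def by blast
      then have "curve_speed A g \<gamma> t = sqrt (D t \<bullet> (g c (snd c (\<gamma> t)) *v D t))"
        using S t by (intro curve_speed_chart[OF A g c _ _ F(3)]) auto
      then have "\<kappa> * norm (D t) \<le> curve_speed A g \<gamma> t"
        using \<kappa>(2)[OF t(1)] by simp
      then show ?thesis
        using True t \<kappa>(1) by (simp add: ennreal_mult[symmetric] ennreal_leI)
    qed simp
  qed
  finally show ?thesis .
qed

text \<open>The start \<open>\<gamma> 0\<close> may be any point of the manifold. A curve that ends
  in the small ball and is shorter than \<open>\<kappa> * r\<close> is trapped in the ball of twice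
  the radius, hence in a single chart, and there the chord estimate applies to the whole
  curve.\<close>

lemma coordinate_dist_le_curve_length:
  fixes g :: "('m::t2_space, 'n::finite) chart \<Rightarrow> real^'n \<Rightarrow> real^'n^'n"
  assumes A: "smooth_atlas A" and g: "riemannian_metric A g" and c: "c \<in> A"
    and \<gamma>: "piecewise_C1_curve A \<gamma>" "\<gamma> 1 = chart_inv c w" and w: "w \<in> cball x r"
    and B: "cball x (2 * r) \<subseteq> chart_image c" and r: "0 < r"
    and \<kappa>: "0 < \<kappa>" "\<And>y v. y \<in> cball x (2 * r) \<Longrightarrow> \<kappa> * norm v \<le> sqrt (v \<bullet> (g c y *v v))"
    and len: "curve_length A g \<gamma> < ennreal (\<kappa> * r)"
  shows "ennreal (\<kappa> * norm (w - snd c (\<gamma> 0))) \<le> curve_length A g \<gamma>"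
proof -
  note hom = smooth_atlas_chart(3)[OF A c]
  define U where "U = chart_inv c ` ball x (2 * r)"
  define V where "V = chart_inv c ` cball x (2 * r)"
  have cont: "continuous_on {0..1} \<gamma>"
    using \<gamma> by (simp add: piecewise_C1_curve_def)
  have ball_sub: "ball x (2 * r) \<subseteq> chart_image c" and w': "w \<in> ball x (2 * r)"
    using B w r by auto
  have "open U"
    unfolding U_def using ball_sub by (intro open_chart_inv_image[OF A c]) auto
  \<comment> \<open>Here the Hausdorff property enters: \<open>V\<close> is compact, hence closed in
    the whole manifold.\<close>
  have "closed V"
    unfolding V_def using B
    by (intro compact_imp_closed compact_continuous_image
        continuous_on_subset[OF homeomorphism_cont2[OF hom]]) auto
  have inv: "snd c (chart_inv c y) = y" if "y \<in> cball x (2 * r)" for y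
    using that B chart_chart_inv by blast
  have V: "V \<subseteq> fst c" "\<And>p. p \<in> V \<Longrightarrow> snd c p \<in> cball x (2 * r)"
    using B inv by (auto simp: V_def intro!: chart_inv_mem)
  have UV: "U \<subseteq> V" by (auto simp: U_def V_def)
  have w1: "snd c (\<gamma> 1) = w" using \<gamma> w' inv by auto
  have chord: "ennreal (\<kappa> * norm (w - snd c (\<gamma> a))) \<le> curve_length A g \<gamma>"
    if "0 \<le> a" "a < 1" "\<gamma> ` {a..1} \<subseteq> V" for a
  proof -
    have "ennreal (\<kappa> * norm (snd c (\<gamma> 1) - snd c (\<gamma> a))) \<le> curve_length A g \<gamma>"
    proof (rule curve_length_ge_chord[OF A g c \<gamma>(1)])
      show "\<kappa> * norm v \<le> sqrt (v \<bullet> (g c (snd c (\<gamma> t)) *v v))" if "t \<in> {a..1}" for t v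
        using that \<open>\<gamma> ` {a..1} \<subseteq> V\<close> V(2) by (intro \<kappa>(2)) blast
    qed (use that V(1) \<kappa>(1) in auto)
    then show ?thesis using w1 by simp
  qed
  \<comment> \<open>After its last time outside the larger ball the curve crosses the shell between the two balls,
    which costs length at least \<open>\<kappa> * r\<close>; so it never leaves the larger ball.\<close>
  define T where "T = {t \<in> {0..1}. \<gamma> t \<in> - U}"
  have "T = {}"
  proof (rule ccontr)
    assume "T \<noteq> {}"
    have "T = {0..1} \<inter> \<gamma> -` (- U)" by (auto simp: T_def)
    then have "closed T"
      using \<open>open U\<close> by (metis closed_Compl closed_atLeastAtMost cont continuous_closed_preimage)
    moreover have "bounded T"
      by (rule bounded_subset[of "{0..1}"]) (auto simp: T_def)
    ultimately obtain a where a: "a \<in> T" "\<And>t. t \<in> T \<Longrightarrow> t \<le> a"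
      using compact_attains_sup[of T] \<open>T \<noteq> {}\<close> compact_eq_bounded_closed by metis
    have "\<gamma> 1 \<in> U" using \<gamma> w' by (auto simp: U_def)
    with a(1) have a01: "0 \<le> a" "a < 1" "\<gamma> a \<notin> U"
      by (auto simp: T_def order_less_le)
    have "\<gamma> t \<in> U" if "a < t" "t \<le> 1" for t
    proof (rule ccontr)
      assume "\<gamma> t \<notin> U"
      then have "t \<in> T" using that a01 by (auto simp: T_def)
      then show False using a(2)[of t] that by simp
    qed
    \<comment> \<open>The curve is in \<open>U\<close> only strictly after time \<open>a\<close>.
      Closedness of \<open>V\<close> adds the time \<open>a\<close> itself, so that the chord
      estimate can start there.\<close>
    then have "{a<..1} \<subseteq> {0..1} \<inter> \<gamma> -` V"
      using a01(1) UV by (auto intro!: subsetD[OF UV])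
    moreover have "closed ({0..1} \<inter> \<gamma> -` V)"
      using \<open>closed V\<close> by (intro continuous_closed_preimage cont) auto
    ultimately have "closure {a<..1} \<subseteq> {0..1} \<inter> \<gamma> -` V"
      by (rule closure_minimal)
    then have aV: "\<gamma> ` {a..1} \<subseteq> V"
      using a01 by auto
    have "snd c (\<gamma> a) \<notin> ball x (2 * r)"
    proof
      assume "snd c (\<gamma> a) \<in> ball x (2 * r)"
      moreover have "\<gamma> a \<in> fst c" using aV V(1) a01(2) by (auto simp: image_subset_iff)
      then have "chart_inv c (snd c (\<gamma> a)) = \<gamma> a"
        using chart_inv_chart[OF A c] by blast
      ultimately show False
        using a01(3) by (metis U_def imageI)
    qed
    then have "r \<le> norm (w - snd c (\<gamma> a))"
      using w dist_triangle[of x "snd c (\<gamma> a)" w] by (simp add: dist_norm)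
    then have "ennreal (\<kappa> * r) \<le> ennreal (\<kappa> * norm (w - snd c (\<gamma> a)))"
      using \<kappa>(1) by (intro ennreal_leI) simp
    also have "\<dots> \<le> curve_length A g \<gamma>"
      using chord[OF a01(1,2) aV] .
    finally show False using len by simp
  qed
  then have "\<gamma> ` {0..1} \<subseteq> V"
    using UV by (auto simp: T_def)
  then show ?thesis
    using chord[of 0] by simp
qed

section \<open>Comparison of the metric with the Euclidean norm\<close>

text \<open>The quadratic form is continuous and positive on the compact product of \<open>K\<close>
  with the unit sphere, so it attains a positive minimum and a maximum there; their square roots are
  the constants. Homogeneity extends the bounds to all vectors.\<close>

lemma riemannian_metric_bounds:
  fixes g :: "('m::topological_space, 'n::finite) chart \<Rightarrow> real^'n \<Rightarrow> real^'n^'n"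
  assumes g: "riemannian_metric A g" and c: "c \<in> A" and K: "compact K" "K \<subseteq> chart_image c"
  shows "\<exists>\<kappa>>0. \<exists>\<Lambda>>0. \<forall>x\<in>K. \<forall>v.
    \<kappa> * norm v \<le> sqrt (v \<bullet> (g c x *v v)) \<and> sqrt (v \<bullet> (g c x *v v)) \<le> \<Lambda> * norm v"
proof (cases "K = {}")
  case True
  then show ?thesis by (auto intro: exI[of _ 1])
next
  case False
  define Q where "Q = (\<lambda>(x, v). v \<bullet> (g c x *v v))"
  define S where "S = K \<times> sphere (0::real^'n) 1"
  have "Ck_on 0 (chart_image c) (g c)"
    using g c unfolding riemannian_metric_def smooth_on_def by blast
  then have "continuous_on (chart_image c) (g c)" by simp
  then have gc: "continuous_on S (\<lambda>p. g c (fst p))"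
  proof (rule continuous_on_compose2)
    show "continuous_on S fst" by (intro continuous_on_fst continuous_on_id)
    show "fst ` S \<subseteq> chart_image c" using K by (auto simp: S_def)
  qed
  have Q: "continuous_on S Q"
    unfolding Q_def case_prod_beta inner_vec_def matrix_vector_mult_def
    using gc by (auto intro!: continuous_intros)
  have "compact S" using K by (auto simp: S_def intro!: compact_Times)
  moreover have "S \<noteq> {}" using False by (auto simp: S_def)
  ultimately obtain p q where pq: "p \<in> S" "\<And>s. s \<in> S \<Longrightarrow> Q p \<le> Q s" "q \<in> S" "\<And>s. s \<in> S \<Longrightarrow> Q s \<le> Q q"
    using continuous_attains_inf[OF _ _ Q] continuous_attains_sup[OF _ _ Q] by metis
  have "Q p > 0"
  proof -
    obtain x v where p: "p = (x, v)" by (cases p)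
    then have "x \<in> chart_image c" "v \<noteq> 0" using pq(1) K by (auto simp: S_def)
    then show ?thesis
      using g c unfolding riemannian_metric_def by (auto simp: p Q_def)
  qed
  moreover have "Q p \<le> Q q" using pq by blast
  moreover have "sqrt (Q p) * norm v \<le> sqrt (v \<bullet> (g c x *v v)) \<and>
      sqrt (v \<bullet> (g c x *v v)) \<le> sqrt (Q q) * norm v" if "x \<in> K" for x v
  proof (cases "v = 0")
    case False
    define e where "e = v /\<^sub>R norm v"
    have v: "v = norm v *\<^sub>R e" using False by (simp add: e_def)
    have "(x, e) \<in> S" using that False by (simp add: S_def e_def)
    then have "Q p \<le> Q (x, e)" "Q (x, e) \<le> Q q" using pq by blast+
    moreover have "v \<bullet> (g c x *v v) = (norm v)\<^sup>2 * Q (x, e)"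
    proof -
      have "g c x *v (norm v *\<^sub>R e) = norm v *\<^sub>R (g c x *v e)"
        using linear_cmul[OF matrix_vector_mul_linear] .
      then show ?thesis
        by (subst (1 2) v) (simp add: Q_def power2_eq_square)
    qed
    then have "sqrt (v \<bullet> (g c x *v v)) = sqrt (Q (x, e)) * norm v"
      by (simp add: real_sqrt_mult)
    ultimately show ?thesis
      by (simp add: mult_right_mono)
  qed simp
  moreover have "0 < sqrt (Q p)" "0 < sqrt (Q q)"
    using \<open>Q p > 0\<close> \<open>Q p \<le> Q q\<close> by auto
  ultimately show ?thesis by blast
qed

section \<open>Volume counting for Euclidean balls\<close>

text \<open>Lebesgue measure is additive on the disjoint balls and monotone; the volume of the unit
  ball is a common factor and cancels.\<close>

lemma card_disjoint_balls_le:
  fixes Z :: "'a::euclidean_space set"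
  assumes "finite Z" "0 < \<delta>" "0 < R" and disj: "disjoint_family_on (\<lambda>z. ball z \<delta>) Z"
    and sub: "\<And>z. z \<in> Z \<Longrightarrow> ball z \<delta> \<subseteq> cball x R"
  shows "real (card Z) * \<delta> ^ DIM('a) \<le> R ^ DIM('a)"
proof -
  let ?v = "unit_ball_vol (real DIM('a))"
  have "real (card Z) * (?v * \<delta> ^ DIM('a)) = (\<Sum>z\<in>Z. measure lborel (ball z \<delta>))"
    using \<open>0 < \<delta>\<close> by (simp add: content_ball)
  also have "\<dots> = measure lborel (\<Union>z\<in>Z. ball z \<delta>)"
    using assms(1) disj emeasure_bounded_finite[OF bounded_ball]
    by (intro measure_finite_Union[symmetric]) (auto simp: less_top)
  also have "\<dots> \<le> measure lborel (cball x R)"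
    using sub \<open>finite Z\<close> by (intro measure_mono_fmeasurable fmeasurable_compact) auto
  also have "\<dots> = ?v * R ^ DIM('a)"
    using \<open>0 < R\<close> by (simp add: content_cball)
  finally have "?v * (real (card Z) * \<delta> ^ DIM('a)) \<le> ?v * R ^ DIM('a)"
    by (simp add: mult_ac)
  then show ?thesis
    using unit_ball_vol_pos[of "real DIM('a)"] by simp
qed

text \<open>Dual to the packing bound, with subadditivity of the measure in place of
  additivity.\<close>

lemma card_covering_balls_ge:
  fixes Z :: "'a::euclidean_space set"
  assumes "finite Z" "0 < \<delta>" "0 < r" and cover: "cball x r \<subseteq> (\<Union>z\<in>Z. cball z \<delta>)"
  shows "r ^ DIM('a) \<le> real (card Z) * \<delta> ^ DIM('a)"
proof -
  let ?v = "unit_ball_vol (real DIM('a))"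
  have "?v * r ^ DIM('a) = measure lborel (cball x r)"
    using \<open>0 < r\<close> by (simp add: content_cball)
  also have "\<dots> \<le> measure lborel (\<Union>z\<in>Z. cball z \<delta>)"
    using cover \<open>finite Z\<close> by (intro measure_mono_fmeasurable fmeasurable_compact compact_UN) auto
  also have "\<dots> \<le> (\<Sum>z\<in>Z. measure lborel (cball z \<delta>))"
    using \<open>finite Z\<close> by (intro measure_UNION_le) auto
  also have "\<dots> = ?v * (real (card Z) * \<delta> ^ DIM('a))"
    using \<open>0 < \<delta>\<close> by (simp add: content_cball mult_ac)
  finally show ?thesis
    using unit_ball_vol_pos[of "real DIM('a)"] by simp
qed

section \<open>Packing and covering by metric balls\<close>

text \<open>Each metric ball of radius \<open>\<rho> / 4\<close> around a point of \<open>F\<close>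
  contains the image of a Euclidean ball of radius \<open>\<eta> * \<rho>\<close>. Disjointness is
  thus inherited by Euclidean balls inside \<open>cball x (2 * r)\<close>, whose number is bounded
  by volume.\<close>

lemma chart_ball_packing_bound:
  fixes g :: "('m::topological_space, 'n::finite) chart \<Rightarrow> real^'n \<Rightarrow> real^'n^'n"
  assumes A: "smooth_atlas A" and g: "riemannian_metric A g" and c: "c \<in> A"
    and r: "0 < r" "cball x (2 * r) \<subseteq> chart_image c" and R: "0 < R"
  obtains C where "0 < C"
    "\<And>\<rho> F. 0 < \<rho> \<Longrightarrow> \<rho> \<le> R \<Longrightarrow> disjoint_family_on (\<lambda>y. metric_ball A g y (\<rho> / 4)) F \<Longrightarrow>
       finite F \<Longrightarrow> F \<subseteq> chart_inv c ` ball x r \<Longrightarrow> real (card F) \<le> C / \<rho> ^ CARD('n)"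
proof -
  obtain \<Lambda> where \<Lambda>: "0 < \<Lambda>"
    "\<And>y v. y \<in> cball x (2 * r) \<Longrightarrow> sqrt (v \<bullet> (g c y *v v)) \<le> \<Lambda> * norm v"
    using riemannian_metric_bounds[OF g c compact_cball r(2)] by metis
  \<comment> \<open>The first bound turns Euclidean distance below \<open>\<eta> * \<rho>\<close>
    into Riemannian distance below \<open>\<rho> / 4\<close>. The second gives
    \<open>\<eta> * \<rho> \<le> r\<close> for all \<open>\<rho> \<le> R\<close>, so the Euclidean
    balls stay where \<open>\<Lambda>\<close> is valid.\<close>
  define \<eta> where "\<eta> = min (1 / (4 * \<Lambda>)) (r / R)"
  have \<eta>: "0 < \<eta>" "\<Lambda> * \<eta> \<le> 1 / 4" "\<eta> * R \<le> r"
    using \<Lambda>(1) r R by (auto simp: \<eta>_def min_def field_simps)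
  show thesis
  proof (rule that[of "(2 * r / \<eta>) ^ CARD('n)"])
    show "0 < (2 * r / \<eta>) ^ CARD('n)" using r \<eta> by simp
    fix \<rho> F
    assume \<rho>: "0 < \<rho>" "\<rho> \<le> R" and disj: "disjoint_family_on (\<lambda>y. metric_ball A g y (\<rho> / 4)) F"
      and F: "finite F" "F \<subseteq> chart_inv c ` ball x r"
    have "\<eta> * \<rho> \<le> \<eta> * R" using \<rho> \<eta> by simp
    then have \<delta>: "0 < \<eta> * \<rho>" "\<eta> * \<rho> \<le> r" using \<rho>(1) \<eta>(1,3) by (simp, linarith)
    have inv: "snd c (chart_inv c z) = z" if "z \<in> cball x (2 * r)" for z
      using that r chart_chart_inv by blast
    have F': "snd c y \<in> ball x r" "chart_inv c (snd c y) = y" if "y \<in> F" for y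
      using that F(2) inv r(1) by auto
    have sub: "ball (snd c y) (\<eta> * \<rho>) \<subseteq> cball x (2 * r)" if "y \<in> F" for y
    proof
      fix z assume "z \<in> ball (snd c y) (\<eta> * \<rho>)"
      then show "z \<in> cball x (2 * r)"
        using F'(1)[OF that] \<delta> dist_triangle[of x z "snd c y"] by simp
    qed
    have mem: "chart_inv c z \<in> metric_ball A g y (\<rho> / 4)"
      if "y \<in> F" "z \<in> ball (snd c y) (\<eta> * \<rho>)" for y z
    proof -
      have "riemannian_dist A g (chart_inv c (snd c y)) (chart_inv c z) \<le> ennreal (\<Lambda> * norm (z - snd c y))"
        using F'(1)[OF that(1)] sub[OF that(1)] that(2) r \<Lambda>
        by (intro riemannian_dist_le_segment[OF A g c convex_cball r(2)]) auto
      moreover have "\<Lambda> * norm (z - snd c y) < \<rho> / 4"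
      proof -
        have "\<Lambda> * norm (z - snd c y) < \<Lambda> * (\<eta> * \<rho>)"
          using that(2) \<Lambda>(1) by (simp add: dist_norm norm_minus_commute)
        also have "\<dots> \<le> 1 / 4 * \<rho>"
          using \<eta>(2) \<rho>(1) by (metis mult.assoc mult_right_mono less_imp_le)
        finally show ?thesis by simp
      qed
      ultimately show ?thesis
        using F'(2)[OF that(1)] \<rho>(1) \<Lambda>(1)
        by (simp add: metric_ball_def ennreal_lessI order_le_less_trans)
    qed
    have "inj_on (snd c) F"
      using F'(2) by (metis inj_onI)
    have "disjoint_family_on (\<lambda>z. ball z (\<eta> * \<rho>)) (snd c ` F)"
      unfolding disjoint_family_on_def
    proof (intro ballI impI equals0I)
      fix a b z
      assume "a \<in> snd c ` F" "b \<in> snd c ` F" "a \<noteq> b" and z: "z \<in> ball a (\<eta> * \<rho>) \<inter> ball b (\<eta> * \<rho>)"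
      then obtain y y' where y: "y \<in> F" "y' \<in> F" "a = snd c y" "b = snd c y'" "y \<noteq> y'" by blast
      then have "chart_inv c z \<in> metric_ball A g y (\<rho> / 4) \<inter> metric_ball A g y' (\<rho> / 4)"
        using mem z by blast
      then show False
        using disj y unfolding disjoint_family_on_def by blast
    qed
    then have "real (card (snd c ` F)) * (\<eta> * \<rho>) ^ CARD('n) \<le> (2 * r) ^ CARD('n)"
      using card_disjoint_balls_le[of "snd c ` F" "\<eta> * \<rho>" "2 * r" x] F(1) \<delta> r sub by auto
    then show "real (card F) \<le> (2 * r / \<eta>) ^ CARD('n) / \<rho> ^ CARD('n)"
      using \<eta> \<rho> card_image[OF \<open>inj_on (snd c) F\<close>]
      by (simp add: power_divide power_mult_distrib field_simps)
  qed
qed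

text \<open>Compactness leaves finitely many coordinate balls that cover the manifold, and their
  packing constants are added. These depend on \<open>R\<close> but not on
  \<open>\<rho>\<close>.\<close>

lemma disjoint_metric_balls_card_le:
  fixes g :: "('m::t2_space, 'n::finite) chart \<Rightarrow> real^'n \<Rightarrow> real^'n^'n"
  assumes M: "compact_riemannian_manifold A g" and R: "0 < R"
  obtains C where "0 < C"
    "\<And>\<rho> Y. 0 < \<rho> \<Longrightarrow> \<rho> \<le> R \<Longrightarrow> disjoint_family_on (\<lambda>y. metric_ball A g y (\<rho> / 4)) Y \<Longrightarrow>
       finite Y \<and> real (card Y) \<le> C / \<rho> ^ CARD('n)"
proof -
  have A: "smooth_atlas A" and g: "riemannian_metric A g" and cpt: "compact (UNIV :: 'm set)"
    using M by (auto simp: compact_riemannian_manifold_def)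
  have "\<exists>U C. p \<in> U \<and> open U \<and> 0 < C \<and> (\<forall>\<rho> F. 0 < \<rho> \<and> \<rho> \<le> R \<and>
      disjoint_family_on (\<lambda>y. metric_ball A g y (\<rho> / 4)) F \<and> finite F \<and> F \<subseteq> U \<longrightarrow>
      real (card F) \<le> C / \<rho> ^ CARD('n))" for p
  proof -
    define c where "c = chart_at A p"
    have c: "c \<in> A" "p \<in> fst c" using chart_at_mem[OF A] by (auto simp: c_def)
    obtain e where e: "0 < e" "cball (snd c p) e \<subseteq> chart_image c"
      using smooth_atlas_chart(2)[OF A c(1)] c(2) open_contains_cball unfolding chart_image_def by blast
    then have r: "0 < e / 2" "cball (snd c p) (2 * (e / 2)) \<subseteq> chart_image c" by auto
    have "open (chart_inv c ` ball (snd c p) (e / 2))"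
      using e by (intro open_chart_inv_image[OF A c(1)]) auto
    moreover have "p \<in> chart_inv c ` ball (snd c p) (e / 2)"
      using chart_inv_chart[OF A c] r(1) by (metis centre_in_ball imageI)
    ultimately show ?thesis
      using chart_ball_packing_bound[OF A g c(1) r R] by metis
  qed
  then obtain U C where U: "\<And>p. p \<in> U p" "\<And>p. open (U p)" "\<And>p. 0 < C p"
    and bound: "\<And>p \<rho> F. 0 < \<rho> \<Longrightarrow> \<rho> \<le> R \<Longrightarrow> disjoint_family_on (\<lambda>y. metric_ball A g y (\<rho> / 4)) F \<Longrightarrow>
      finite F \<Longrightarrow> F \<subseteq> U p \<Longrightarrow> real (card F) \<le> C p / \<rho> ^ CARD('n)"
    by metis
  obtain T where "T \<subseteq> UNIV" and T: "finite T" "UNIV \<subseteq> (\<Union>p\<in>T. U p)"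
    by (rule compactE_image[OF cpt, of UNIV U]) (use U in auto)
  have "T \<noteq> {}" using T by auto
  show thesis
  proof (rule that[of "\<Sum>p\<in>T. C p"])
    show "0 < (\<Sum>p\<in>T. C p)" using T \<open>T \<noteq> {}\<close> U by (intro sum_pos) auto
    fix \<rho> Y assume \<rho>: "0 < \<rho>" "\<rho> \<le> R" and Y: "disjoint_family_on (\<lambda>y. metric_ball A g y (\<rho> / 4)) Y"
    \<comment> \<open>Finiteness of \<open>Y\<close> is not given. A bound that is uniform over its
      finite subsets forces it, since an infinite \<open>Y\<close> would have a finite subset with
      too many points.\<close>
    have fin: "real (card F) \<le> (\<Sum>p\<in>T. C p) / \<rho> ^ CARD('n)" if "finite F" "F \<subseteq> Y" for F
    proof -
      have "F = (\<Union>p\<in>T. F \<inter> U p)" using T by auto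
      then have "card F \<le> (\<Sum>p\<in>T. card (F \<inter> U p))"
        using card_UN_le[OF T(1), of "\<lambda>p. F \<inter> U p"] by simp
      then have "real (card F) \<le> (\<Sum>p\<in>T. real (card (F \<inter> U p)))"
        by (metis of_nat_mono of_nat_sum)
      also have "\<dots> \<le> (\<Sum>p\<in>T. C p / \<rho> ^ CARD('n))"
        using \<rho> that by (intro sum_mono bound disjoint_family_on_mono[OF _ Y]) auto
      finally show ?thesis by (simp add: sum_divide_distrib)
    qed
    have "finite Y"
    proof (rule ccontr)
      assume "infinite Y"
      then obtain F where "F \<subseteq> Y" "finite F" "card F = Suc (nat \<lceil>(\<Sum>p\<in>T. C p) / \<rho> ^ CARD('n)\<rceil>)"
        by (meson infinite_arbitrarily_large)
      then show False using fin[of F] by linarith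
    qed
    then show "finite Y \<and> real (card Y) \<le> (\<Sum>p\<in>T. C p) / \<rho> ^ CARD('n)"
      using fin by blast
  qed
qed

text \<open>It is enough to look at one coordinate ball \<open>cball x r\<close>. The coordinates of
  its points lying in a metric ball of radius \<open>\<rho> / 2\<close> around \<open>y\<close> are
  within \<open>\<rho> / \<kappa>\<close> of \<open>snd c y\<close>, so Euclidean balls of that
  radius cover it.\<close>

lemma covering_metric_balls_card_ge:
  fixes g :: "('m::t2_space, 'n::finite) chart \<Rightarrow> real^'n \<Rightarrow> real^'n^'n"
  assumes A: "smooth_atlas A" and g: "riemannian_metric A g"
  obtains C where "0 < C"
    "\<And>\<rho> Y. 0 < \<rho> \<Longrightarrow> finite Y \<Longrightarrow> (\<Union>y\<in>Y. metric_ball A g y (\<rho> / 2)) = UNIV \<Longrightarrow>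
       C / \<rho> ^ CARD('n) \<le> real (card Y)"
proof -
  obtain p :: 'm where True by blast
  define c where "c = chart_at A p"
  define x where "x = snd c p"
  have c: "c \<in> A" "p \<in> fst c" using chart_at_mem[OF A] by (auto simp: c_def)
  obtain e where e: "0 < e" "cball x e \<subseteq> chart_image c"
    using smooth_atlas_chart(2)[OF A c(1)] c(2) open_contains_cball
    unfolding chart_image_def x_def by blast
  define r where "r = e / 2"
  have r: "0 < r" "cball x (2 * r) \<subseteq> chart_image c" using e by (auto simp: r_def)
  obtain \<kappa> where \<kappa>: "0 < \<kappa>"
    "\<And>y v. y \<in> cball x (2 * r) \<Longrightarrow> \<kappa> * norm v \<le> sqrt (v \<bullet> (g c y *v v))"
    using riemannian_metric_bounds[OF g c(1) compact_cball r(2)] by metis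
  show thesis
  proof (rule that[of "(\<kappa> * r) ^ CARD('n)"])
    show "0 < (\<kappa> * r) ^ CARD('n)" using \<kappa> r by simp
    fix \<rho> and Y :: "'m set"
    assume \<rho>: "0 < \<rho>" and Y: "finite Y" "(\<Union>y\<in>Y. metric_ball A g y (\<rho> / 2)) = UNIV"
    have "(\<kappa> * r) ^ CARD('n) \<le> real (card Y) * \<rho> ^ CARD('n)"
    \<comment> \<open>The coordinate estimate needs curves shorter than \<open>\<kappa> * r\<close>.
      For larger \<open>\<rho>\<close> the claimed bound is at most one, and a cover of the manifold
      has at least one ball.\<close>
    proof (cases "\<rho> / 2 \<le> \<kappa> * r")
      case True
      have "cball x r \<subseteq> (\<Union>z\<in>snd c ` Y. cball z (\<rho> / \<kappa>))"
      proof
        fix w assume w: "w \<in> cball x r"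
        obtain y where y: "y \<in> Y" "riemannian_dist A g y (chart_inv c w) < ennreal (\<rho> / 2)"
          using Y(2) by (auto simp: metric_ball_def)
        then obtain \<gamma> where \<gamma>: "piecewise_C1_curve A \<gamma>" "\<gamma> 0 = y" "\<gamma> 1 = chart_inv c w"
          and len: "curve_length A g \<gamma> < ennreal (\<rho> / 2)"
          unfolding riemannian_dist_def by (auto simp: INF_less_iff)
        have "curve_length A g \<gamma> < ennreal (\<kappa> * r)"
          using len True by (meson ennreal_leI order_less_le_trans)
        then have "ennreal (\<kappa> * norm (w - snd c y)) \<le> curve_length A g \<gamma>"
          using coordinate_dist_le_curve_length[OF A g c(1) \<gamma>(1,3) w r(2,1) \<kappa>] \<gamma>(2) by simp
        then have "ennreal (\<kappa> * norm (w - snd c y)) < ennreal (\<rho> / 2)"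
          using len by simp
        then have "\<kappa> * norm (w - snd c y) < \<rho> / 2"
          using \<kappa>(1) by (simp add: ennreal_less_iff)
        then have "norm (w - snd c y) \<le> \<rho> / \<kappa>"
          using \<kappa>(1) \<rho> by (simp add: field_simps)
        then show "w \<in> (\<Union>z\<in>snd c ` Y. cball z (\<rho> / \<kappa>))"
          using y(1) by (auto simp: dist_norm norm_minus_commute)
      qed
      then have "r ^ CARD('n) \<le> real (card (snd c ` Y)) * (\<rho> / \<kappa>) ^ CARD('n)"
        using card_covering_balls_ge[of "snd c ` Y" "\<rho> / \<kappa>" r x] Y(1) \<rho> \<kappa>(1) r(1) by simp
      \<comment> \<open>Points of \<open>Y\<close> outside the chart have arbitrary values under
        \<open>snd c\<close>, possibly coinciding; the image has at most as many points as
        \<open>Y\<close>, which is the direction required.\<close>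
      also have "\<dots> \<le> real (card Y) * (\<rho> / \<kappa>) ^ CARD('n)"
        using card_image_le[OF Y(1)] \<rho> \<kappa>(1) by (intro mult_right_mono) auto
      finally show ?thesis
        using \<kappa>(1) by (simp add: power_divide power_mult_distrib field_simps)
    next
      case False
      have "Y \<noteq> {}" using Y(2) by auto
      then have "1 \<le> real (card Y)" using Y(1) by (simp add: Suc_le_eq card_gt_0_iff)
      moreover have "(\<kappa> * r) ^ CARD('n) \<le> \<rho> ^ CARD('n)"
        using False \<kappa> r \<rho> by (intro power_mono) auto
      ultimately show ?thesis
        using mult_mono[of 1 "real (card Y)" "(\<kappa> * r) ^ CARD('n)" "\<rho> ^ CARD('n)"] \<kappa> r by simp
    qed
    then show "(\<kappa> * r) ^ CARD('n) / \<rho> ^ CARD('n) \<le> real (card Y)"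
      using \<rho> by (simp add: field_simps)
  qed
qed

section \<open>The bounds in terms of \<omega>\<close>

text \<open>The constants are uniform over all \<open>\<omega> \<ge> \<omega>\<^sub>0\<close>;
  choosing them after a single \<open>\<omega>\<close> would say little. Uniformity down to zero
  cannot be asked of the upper bound in general: a lattice has at least one point, while
  \<open>\<omega> powr (real CARD('n) / 2)\<close> tends to zero.\<close>

theorem theorem2p5:
  fixes A :: "('m::t2_space, 'n::finite) chart set"
    and g :: "('m, 'n) chart \<Rightarrow> real^'n \<Rightarrow> real^'n^'n"
    and L :: "('m \<Rightarrow> complex) \<Rightarrow> 'm \<Rightarrow> complex"
    and lam :: "nat \<Rightarrow> real"
    and u :: "nat \<Rightarrow> 'm \<Rightarrow> complex"
    and N :: nat
    and P :: "(('m, 'n) chart \<times> (real^'n) set) set"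
    and s :: "nat \<Rightarrow> nat"
    and C\<^sub>2 \<rho>\<^sub>0 :: real
  assumes "compact_riemannian_manifold A g"
    and "elliptic_second_order A L"
    and "self_adjoint (riemannian_volume A g) (closure_graph A (riemannian_volume A g) L)"
    and "discrete_spectrum (riemannian_volume A g) (closure_graph A (riemannian_volume A g) L) lam u"
    and "lattice_multiplicity A g N"
    and "compact_chart_cover A P"
    and "\<And>m. s m \<le> m"
    and "C\<^sub>2 > 0" and "\<rho>\<^sub>0 > 0"
    and "sampling_estimate A g N lam u P s C\<^sub>2 \<rho>\<^sub>0"
  shows "\<forall>\<omega>\<^sub>0>0. \<exists>a\<^sub>1>0. \<exists>a\<^sub>2>0. \<forall>\<omega>\<ge>\<omega>\<^sub>0. \<forall>Y.
           is_lattice A g N (c0 CARD('n) C\<^sub>2 * \<omega> powr (- 1 / 2)) Y \<longrightarrow>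
             finite Y \<and>
             a\<^sub>1 * \<omega> powr (real CARD('n) / 2) \<le> real (card Y) \<and>
             real (card Y) \<le> a\<^sub>2 * \<omega> powr (real CARD('n) / 2)"
proof (intro allI impI)
  fix \<omega>\<^sub>0 :: real assume \<omega>\<^sub>0: "0 < \<omega>\<^sub>0"
  define n where "n = CARD('n)"
  define \<beta> where "\<beta> = c0 n C\<^sub>2"
  have \<beta>: "0 < \<beta>" using \<open>C\<^sub>2 > 0\<close> by (simp add: \<beta>_def c0_def)
  have A: "smooth_atlas A" and g: "riemannian_metric A g"
    using \<open>compact_riemannian_manifold A g\<close> by (auto simp: compact_riemannian_manifold_def)
  \<comment> \<open>The largest radius that occurs, as the exponent is negative; it fixes the
    packing constant \<open>C\<close>, whereas \<open>B\<close> is independent of it.\<close>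
  define R where "R = \<beta> * \<omega>\<^sub>0 powr (- 1 / 2)"
  have R: "0 < R" using \<beta> \<omega>\<^sub>0 by (simp add: R_def)
  obtain C where C: "0 < C"
    "\<And>\<rho> Y. 0 < \<rho> \<Longrightarrow> \<rho> \<le> R \<Longrightarrow> disjoint_family_on (\<lambda>y. metric_ball A g y (\<rho> / 4)) Y \<Longrightarrow>
       finite Y \<and> real (card Y) \<le> C / \<rho> ^ n"
    using disjoint_metric_balls_card_le[OF \<open>compact_riemannian_manifold A g\<close> R] unfolding n_def by metis
  obtain B where B: "0 < B"
    "\<And>\<rho> Y. 0 < \<rho> \<Longrightarrow> finite Y \<Longrightarrow> (\<Union>y\<in>Y. metric_ball A g y (\<rho> / 2)) = UNIV \<Longrightarrow>
       B / \<rho> ^ n \<le> real (card Y)"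
    using covering_metric_balls_card_ge[OF A g] unfolding n_def by metis
  have bounds: "finite Y \<and> B / \<beta> ^ n * \<omega> powr (real n / 2) \<le> real (card Y) \<and>
      real (card Y) \<le> C / \<beta> ^ n * \<omega> powr (real n / 2)"
    if \<omega>: "\<omega> \<ge> \<omega>\<^sub>0" and Y: "is_lattice A g N (\<beta> * \<omega> powr (- 1 / 2)) Y" for \<omega> Y
  proof -
    define \<rho> where "\<rho> = \<beta> * \<omega> powr (- 1 / 2)"
    have "0 < \<rho>" using \<beta> \<omega> \<omega>\<^sub>0 by (simp add: \<rho>_def)
    moreover have "\<rho> \<le> R"
      using \<beta> \<omega> \<omega>\<^sub>0 by (auto simp: \<rho>_def R_def intro!: powr_mono2')
    moreover have "disjoint_family_on (\<lambda>y. metric_ball A g y (\<rho> / 4)) Y"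
      "(\<Union>y\<in>Y. metric_ball A g y (\<rho> / 2)) = UNIV"
      using Y by (simp_all add: is_lattice_def \<rho>_def)
    ultimately have *: "finite Y" "real (card Y) \<le> C / \<rho> ^ n" "B / \<rho> ^ n \<le> real (card Y)"
      using B(2)[of \<rho> Y] C(2)[of \<rho> Y] by auto
    \<comment> \<open>Dividing by \<open>\<rho> ^ n\<close> is multiplying by
      \<open>\<omega> powr (real n / 2) / \<beta> ^ n\<close>, which is where the factors
      \<open>B / \<beta> ^ n\<close> and \<open>C / \<beta> ^ n\<close> come from.\<close>
    have "(\<omega> powr (- 1 / 2)) ^ n = (\<omega> powr (- 1 / 2)) powr real n"
      by (rule powr_realpow[symmetric]) (use \<omega> \<omega>\<^sub>0 in simp)
    also have "\<dots> = \<omega> powr (- (real n / 2))"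
      unfolding powr_powr by (rule arg_cong[where f = "(powr) \<omega>"]) simp
    finally have "\<rho> ^ n = \<beta> ^ n / \<omega> powr (real n / 2)"
      unfolding \<rho>_def power_mult_distrib powr_minus divide_inverse by (rule arg_cong)
    then show ?thesis
      using * by simp
  qed
  show "\<exists>a\<^sub>1>0. \<exists>a\<^sub>2>0. \<forall>\<omega>\<ge>\<omega>\<^sub>0. \<forall>Y.
           is_lattice A g N (c0 CARD('n) C\<^sub>2 * \<omega> powr (- 1 / 2)) Y \<longrightarrow>
             finite Y \<and>
             a\<^sub>1 * \<omega> powr (real CARD('n) / 2) \<le> real (card Y) \<and>
             real (card Y) \<le> a\<^sub>2 * \<omega> powr (real CARD('n) / 2)"
    unfolding \<beta>_def[symmetric] n_def[symmetric]
  proof (rule exI[of _ "B / \<beta> ^ n"], rule conjI)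
    show "\<exists>a\<^sub>2>0. \<forall>\<omega>\<ge>\<omega>\<^sub>0. \<forall>Y. is_lattice A g N (\<beta> * \<omega> powr (- 1 / 2)) Y \<longrightarrow>
        finite Y \<and> B / \<beta> ^ n * \<omega> powr (real n / 2) \<le> real (card Y) \<and>
        real (card Y) \<le> a\<^sub>2 * \<omega> powr (real n / 2)"
    proof (rule exI[of _ "C / \<beta> ^ n"], rule conjI)
      show "\<forall>\<omega>\<ge>\<omega>\<^sub>0. \<forall>Y. is_lattice A g N (\<beta> * \<omega> powr (- 1 / 2)) Y \<longrightarrow>
        finite Y \<and> B / \<beta> ^ n * \<omega> powr (real n / 2) \<le> real (card Y) \<and>
        real (card Y) \<le> C / \<beta> ^ n * \<omega> powr (real n / 2)"
        by (intro allI impI bounds)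
    qed (use C \<beta> in simp)
  qed (use B \<beta> in simp)
qed

end
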